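(* Let $k$ be a symmetric positive-definite kernel on $\mathbb{R}^n$ with reproducing kernel Hilbert space $\mathcal{H}_k$, and let $x\in\mathbb{R}^n$ be a random vector with prescribed probability density function $p_x$. Suppose that, for each $N$, $\bar y_N$ and $\bar\sigma_N$ are the predictive mean and predictive standard deviation given by Gaussian process regression (GPR) with kernel $k$ using $N$ samples. Moreover, assume that sampling is performed using the optimal (output-weighted) criterion so that $$\lim_{N\to\infty}\int\frac{p_x(x)}{p_{\bar y_N}(\bar y_N(x))}\,\bar\sigma_N^2(x)\,\mathrm{d}x=0.$$ Then we have convergence in measure, i.e., for every $q>0$, $$\lim_{N\to\infty}P\left[x:\ \sup_{\|y\|_{\mathcal{H}_k}=1}\left(\bar y_N(x)-y(x)\right)^2\le q\,\frac{p_{\bar y_N}(\bar y_N(x))}{p_x(x)}\right]=1.$$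
   Context: Reproducing kernel Hilbert space: $\mathcal{H}_k$ is the Hilbert space of functions $\mathbb{R}^n\to\mathbb{R}$ such that $k(x,\cdot)\in\mathcal{H}_k$ for all $x\in\mathbb{R}^n$ and $\langle y,k(x,\cdot)\rangle_{\mathcal{H}_k}=y(x)$ for all $x\in\mathbb{R}^n$, $y\in\mathcal{H}_k$. GPR with $N$ samples: given input datapoints $X=\{x_i\}_{i=1}^N\subset\mathbb{R}^n$ and output values $Y=[y(x_1),\dots,y(x_N)]^{\mathsf T}$ of the function $y$ being approximated (zero prior mean, noiseless observations), set $k(x,X)=[k(x,x_1),\dots,k(x,x_N)]$, $k(X,x)=k(x,X)^{\mathsf T}$ and $K(X,X)=\{k(x_i,x_j)\}_{i,j=1}^N$. Then $$\bar y_N(x)=k(x,X)K(X,X)^{-1}Y,\qquad \bar\sigma_N^2(x)=k(x,x)-k(x,X)K(X,X)^{-1}k(X,x).$$ In the supremum over $y$, at each fixed $x$, $\bar y_N$ is the GPR approximation of the function $y$ over which the supremum is taken. For a function $f:\mathbb{R}^n\to\mathbb{R}$, $p_f$ denotes the probability density function of $f(x)$ when $x$ has density $p_x$. $P$ denotes probability with respect to the input $x$. Optimal (output-weighted) sampling criterion: given $N$ samples, the next input point $x_{N+1}=h\in\mathbb{R}^n$ is chosen by minimizing over $h$ the quantity $\int\frac{p_x(x)}{p_{\bar y_N}(\bar y_N(x))}\,\bar\sigma^2(x;h)\,\mathrm{d}x$, where $\bar\sigma^2(x;h)$ is the predictive variance when the dataset is augmented by the input $h$. What is assumed about the sampling in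 the theorem is the displayed limit condition. *)

theory Defs
  imports
    "HOL-Probability.Probability"
    "Jordan_Normal_Form.Gauss_Jordan_Elimination"
begin

definition sym_kernel :: "('x \<Rightarrow> 'x \<Rightarrow> real) \<Rightarrow> bool" where
  "sym_kernel k \<longleftrightarrow> (\<forall>x x'. k x x' = k x' x)"

text \<open>
  Positive definiteness in the sense of reproducing kernel theory: Gram matrices are positive
  semidefinite. Invertibility of the Gram matrix at the data points, which the formulas of
  Gaussian process regression need, is a separate requirement; a strictly positive definite
  kernel satisfies it at pairwise distinct points.
\<close>

definition pos_def_kernel :: "('x \<Rightarrow> 'x \<Rightarrow> real) \<Rightarrow> bool" where
  "pos_def_kernel k \<longleftrightarrow>
     (\<forall>(m::nat) (z::nat \<Rightarrow> 'x) (c::nat \<Rightarrow> real).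
        0 \<le> (\<Sum>i<m. \<Sum>j<m. c i * c j * k (z i) (z j)))"

definition ip_norm :: "('f \<Rightarrow> 'f \<Rightarrow> real) \<Rightarrow> 'f \<Rightarrow> real" where
  "ip_norm ip f = sqrt (ip f f)"

text \<open>
  The set \<open>H\<close> of functions with the inner product \<open>ip\<close> is the reproducing kernel Hilbert space
  of \<open>k\<close>. The pair is determined by \<open>k\<close>, up to the values of \<open>ip\<close> outside \<open>H\<close>.
\<close>

locale rkhs =
  fixes k :: "'x \<Rightarrow> 'x \<Rightarrow> real"
    and H :: "('x \<Rightarrow> real) set"
    and ip :: "('x \<Rightarrow> real) \<Rightarrow> ('x \<Rightarrow> real) \<Rightarrow> real"
  assumes zero_mem: "(\<lambda>_. 0) \<in> H"
    and add_mem: "\<lbrakk>f \<in> H; g \<in> H\<rbrakk> \<Longrightarrow> (\<lambda>x. f x + g x) \<in> H"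
    and scale_mem: "f \<in> H \<Longrightarrow> (\<lambda>x. a * f x) \<in> H"
    and ip_commute: "\<lbrakk>f \<in> H; g \<in> H\<rbrakk> \<Longrightarrow> ip f g = ip g f"
    and ip_add_left: "\<lbrakk>f \<in> H; g \<in> H; h \<in> H\<rbrakk> \<Longrightarrow> ip (\<lambda>x. f x + g x) h = ip f h + ip g h"
    and ip_scale_left: "\<lbrakk>f \<in> H; g \<in> H\<rbrakk> \<Longrightarrow> ip (\<lambda>x. a * f x) g = a * ip f g"
    and ip_nonneg: "f \<in> H \<Longrightarrow> 0 \<le> ip f f"
    and ip_definite: "\<lbrakk>f \<in> H; ip f f = 0\<rbrakk> \<Longrightarrow> f = (\<lambda>_. 0)"
    and complete: "Metric_space.mcomplete H (\<lambda>f g. ip_norm ip (\<lambda>x. f x - g x))"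
    and kernel_mem: "k x \<in> H"
    and reproducing: "y \<in> H \<Longrightarrow> ip y (k x) = y x"

text \<open>
  Gaussian process regression with the data points \<open>X 0, \<dots>, X (N - 1)\<close>. The vector
  \<open>kernel_vec k X N x\<close> stands for both the row \<open>k(x,X)\<close> and the column \<open>k(X,x)\<close>.
\<close>

definition kernel_vec :: "('x \<Rightarrow> 'x \<Rightarrow> real) \<Rightarrow> (nat \<Rightarrow> 'x) \<Rightarrow> nat \<Rightarrow> 'x \<Rightarrow> real Matrix.vec" where
  "kernel_vec k X N x = Matrix.vec N (\<lambda>i. k x (X i))"

definition gram :: "('x \<Rightarrow> 'x \<Rightarrow> real) \<Rightarrow> (nat \<Rightarrow> 'x) \<Rightarrow> nat \<Rightarrow> real Matrix.mat" where
  "gram k X N = Matrix.mat N N (\<lambda>(i, j). k (X i) (X j))"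

definition outputs :: "('x \<Rightarrow> real) \<Rightarrow> (nat \<Rightarrow> 'x) \<Rightarrow> nat \<Rightarrow> real Matrix.vec" where
  "outputs y X N = Matrix.vec N (\<lambda>i. y (X i))"

text \<open>The inverse is meaningful only if the Gram matrix is invertible.\<close>

definition gram_inv :: "('x \<Rightarrow> 'x \<Rightarrow> real) \<Rightarrow> (nat \<Rightarrow> 'x) \<Rightarrow> nat \<Rightarrow> real Matrix.mat" where
  "gram_inv k X N = the (mat_inverse (gram k X N))"

definition gpr_mean ::
    "('x \<Rightarrow> 'x \<Rightarrow> real) \<Rightarrow> (nat \<Rightarrow> 'x) \<Rightarrow> nat \<Rightarrow> ('x \<Rightarrow> real) \<Rightarrow> 'x \<Rightarrow> real" where
  "gpr_mean k X N y x = kernel_vec k X N x \<bullet> (gram_inv k X N *\<^sub>v outputs y X N)"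

definition gpr_var :: "('x \<Rightarrow> 'x \<Rightarrow> real) \<Rightarrow> (nat \<Rightarrow> 'x) \<Rightarrow> nat \<Rightarrow> 'x \<Rightarrow> real" where
  "gpr_var k X N x =
     k x x - kernel_vec k X N x \<bullet> (gram_inv k X N *\<^sub>v kernel_vec k X N x)"

definition gpr_sd :: "('x \<Rightarrow> 'x \<Rightarrow> real) \<Rightarrow> (nat \<Rightarrow> 'x) \<Rightarrow> nat \<Rightarrow> 'x \<Rightarrow> real" where
  "gpr_sd k X N x = sqrt (gpr_var k X N x)"

text \<open>
  \<open>p\<close> is a probability density function of \<open>f(x)\<close> for an input \<open>x\<close> with law \<open>P\<close>. It is
  determined only almost everywhere; any version is admitted.
\<close>

definition is_pdf_of :: "'x measure \<Rightarrow> ('x \<Rightarrow> real) \<Rightarrow> (real \<Rightarrow> real) \<Rightarrow> bool" where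
  "is_pdf_of P f p \<longleftrightarrow> (\<forall>t. 0 \<le> p t) \<and> distributed P lborel f (\<lambda>t. ennreal (p t))"

end

theory Submission
  imports Defs
begin

text \<open>
  The weights \<open>w = K(X,X)\<^sup>-\<^sup>1 k(X,x)\<close> give \<open>y(x) - mean y x = ip y g\<close> for the residual
  \<open>g = k(x,\<cdot>) - (\<Sum>i. w i * k(X i,\<cdot>))\<close>, which vanishes at the data points, so
  \<open>ip g g = g(x)\<close> is the predictive variance. By Cauchy-Schwarz, with equality at the normalized
  residual, the worst-case squared error over the unit sphere is exactly the variance.
  Markov's inequality for Lebesgue measure then shows that the weighted variance
  \<open>p\<^sub>x \<sigma>\<^sup>2 / p\<close> tends to \<open>0\<close> in Lebesgue measure, and absolute continuity of the input law
  carries this over to the probability.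
\<close>

section \<open>Linear algebra of the Gram matrix and the regression weights\<close>

lemma gram_inv_carrier_right_inverse:
  assumes "invertible_mat (gram k X N)"
  shows "gram_inv k X N \<in> carrier_mat N N" "gram k X N * gram_inv k X N = 1\<^sub>m N"
proof -
  let ?K = "gram k X N"
  have K: "?K \<in> carrier_mat N N"
    by (simp add: gram_def)
  obtain B where B: "inverts_mat ?K B" "inverts_mat B ?K"
    using assms by (auto simp: invertible_mat_def)
  \<comment> \<open>\<open>invertible_mat\<close> leaves the shape of the inverse open; both
    products being identity matrices forces it to be N by N.\<close>
  have "dim_col B = N"
    using arg_cong[OF B(1)[unfolded inverts_mat_def], of dim_col] K by simp
  moreover have "dim_row B = N"
    using arg_cong[OF B(2)[unfolded inverts_mat_def], of dim_col] K by simp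
  ultimately have "B \<in> carrier_mat N N"
    by blast
  then have "?K \<in> Units (ring_mat TYPE(real) N ())"
    using B K by (auto simp: Units_def ring_mat_def inverts_mat_def intro!: bexI[of _ B])
  then obtain C where C: "mat_inverse ?K = Some C"
    using mat_inverse(1)[OF K, where b = "()"] by (cases "mat_inverse ?K") auto
  then show "gram_inv k X N \<in> carrier_mat N N" "?K * gram_inv k X N = 1\<^sub>m N"
    using mat_inverse(2)[OF K C] by (auto simp: gram_inv_def)
qed

text \<open>For an invertible Gram matrix in the RKHS setting, these are the coefficients of the
  orthogonal projection of \<open>k x\<close> onto the span of the sections
  \<open>k (X i)\<close>.\<close>

definition gpr_weights :: "('x \<Rightarrow> 'x \<Rightarrow> real) \<Rightarrow> (nat \<Rightarrow> 'x) \<Rightarrow> nat \<Rightarrow> 'x \<Rightarrow> real Matrix.vec" where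
  "gpr_weights k X N x = gram_inv k X N *\<^sub>v kernel_vec k X N x"

lemma gram_mult_gram_inv_vec:
  assumes "invertible_mat (gram k X N)" "v \<in> carrier_vec N"
  shows "gram k X N *\<^sub>v (gram_inv k X N *\<^sub>v v) = v"
proof -
  have "gram k X N \<in> carrier_mat N N"
    by (simp add: gram_def)
  then show ?thesis
    using gram_inv_carrier_right_inverse[OF assms(1)] assms(2)
    by (metis assoc_mult_mat_vec one_mult_mat_vec)
qed

text \<open>Write the kernel vector as \<open>K a\<close> and the outputs as \<open>K b\<close>;
  symmetry of the Gram matrix \<open>K\<close> moves it across the scalar product. The mean is thus
  linear in \<open>y\<close>, with weights independent of \<open>y\<close>.\<close>

lemma gpr_mean_eq_weights:
  assumes "sym_kernel k" and inv: "invertible_mat (gram k X N)"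
  shows "gpr_mean k X N y x = (\<Sum>i<N. vec_index (gpr_weights k X N x) i * y (X i))"
proof -
  let ?K = "gram k X N" and ?a = "gpr_weights k X N x"
  let ?b = "gram_inv k X N *\<^sub>v outputs y X N"
  have K: "?K \<in> carrier_mat N N" and KT: "transpose_mat ?K = ?K"
    using assms(1) by (auto simp: gram_def sym_kernel_def)
  have a: "?a \<in> carrier_vec N" and b: "?b \<in> carrier_vec N"
    using gram_inv_carrier_right_inverse(1)[OF inv]
    by (auto simp: gpr_weights_def kernel_vec_def outputs_def)
  have "gpr_mean k X N y x = scalar_prod (?K *\<^sub>v ?a) ?b"
    using gram_mult_gram_inv_vec[OF inv, of "kernel_vec k X N x"]
    by (simp add: gpr_mean_def gpr_weights_def kernel_vec_def)
  also have "\<dots> = scalar_prod ?a (?K *\<^sub>v ?b)"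
    using transpose_vec_mult_scalar[OF K b a] KT by simp
  also have "?K *\<^sub>v ?b = outputs y X N"
    using gram_mult_gram_inv_vec[OF inv, of "outputs y X N"] by (simp add: outputs_def)
  finally show ?thesis
    by (simp add: scalar_prod_def outputs_def atLeast0LessThan)
qed

text \<open>This is row \<open>i\<close> of the linear system solved by the weights. It makes the
  residual vanish at the data points.\<close>

lemma gpr_mean_kernel_at_sample:
  assumes "sym_kernel k" "invertible_mat (gram k X N)" "i < N"
  shows "gpr_mean k X N (k (X i)) x = k x (X i)"
proof -
  have "gram k X N *\<^sub>v gpr_weights k X N x = kernel_vec k X N x"
    using gram_mult_gram_inv_vec[OF assms(2), of "kernel_vec k X N x"]
    by (simp add: gpr_weights_def kernel_vec_def)
  moreover have "gpr_weights k X N x \<in> carrier_vec N"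
    using gram_inv_carrier_right_inverse(1)[OF assms(2)]
    by (auto simp: gpr_weights_def kernel_vec_def)
  ultimately have "(\<Sum>j<N. k (X i) (X j) * vec_index (gpr_weights k X N x) j) = k x (X i)"
    using assms(3)
    by (auto simp: vec_eq_iff gram_def kernel_vec_def scalar_prod_def atLeast0LessThan)
  then show ?thesis
    by (simp add: gpr_mean_eq_weights[OF assms(1,2)] mult.commute)
qed

text \<open>The outputs of the section \<open>k x\<close> at the data points are exactly the kernel
  vector.\<close>

lemma gpr_var_eq_mean:
  "gpr_var k X N x = k x x - gpr_mean k X N (k x) x"
  by (simp add: gpr_var_def gpr_mean_def kernel_vec_def outputs_def)

section \<open>Worst-case error in the reproducing kernel Hilbert space\<close>

context rkhs
begin

lemma kernel_sym: "sym_kernel k"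
  unfolding sym_kernel_def by (metis ip_commute kernel_mem reproducing)

lemma ip_add_right: "\<lbrakk>f \<in> H; g \<in> H; h \<in> H\<rbrakk> \<Longrightarrow> ip h (\<lambda>x. f x + g x) = ip h f + ip h g"
  by (simp add: ip_commute[of h] add_mem ip_add_left)

lemma ip_scale_right: "\<lbrakk>f \<in> H; g \<in> H\<rbrakk> \<Longrightarrow> ip g (\<lambda>x. a * f x) = a * ip g f"
  by (simp add: ip_commute[of g] scale_mem ip_scale_left)

lemma kernel_sum_mem: "(\<lambda>z. \<Sum>i<(N::nat). c i * k (X i) z) \<in> H"
proof (induction N)
  case 0
  show ?case
    by (simp add: zero_mem)
next
  case (Suc N)
  show ?case
    using add_mem[OF Suc scale_mem[OF kernel_mem, of "c N" "X N"]] by simp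
qed

lemma ip_kernel_sum:
  assumes "y \<in> H"
  shows "ip y (\<lambda>z. \<Sum>i<(N::nat). c i * k (X i) z) = (\<Sum>i<N. c i * y (X i))"
proof (induction N)
  case 0
  show ?case
    \<comment> \<open>Homogeneity with factor 0 makes \<open>ip y\<close> vanish at the zero
      function.\<close>
    using ip_scale_right[OF zero_mem assms, of 0] by simp
next
  case (Suc N)
  then show ?case
    using ip_add_right[OF kernel_sum_mem[of c X N] scale_mem[OF kernel_mem, of "c N" "X N"] assms]
    by (simp add: ip_scale_right kernel_mem assms reproducing)
qed

lemma Cauchy_Schwarz:
  assumes "f \<in> H" "g \<in> H"
  shows "(ip f g)\<^sup>2 \<le> ip f f * ip g g"
proof (cases "ip g g = 0")
  case True
  then have "g = (\<lambda>x. 0 * g x)"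
    using ip_definite assms by auto
  then have "ip f g = 0"
    using ip_scale_right[OF assms(2,1), of 0] by simp
  then show ?thesis
    using True by simp
next
  case False
  \<comment> \<open>The minimizer of the squared norm of \<open>f + t g\<close> over real
    \<open>t\<close>.\<close>
  define t where "t = - (ip f g / ip g g)"
  have tg: "(\<lambda>x. t * g x) \<in> H"
    by (rule scale_mem[OF assms(2)])
  have "0 \<le> ip (\<lambda>x. f x + t * g x) (\<lambda>x. f x + t * g x)"
    by (intro ip_nonneg add_mem assms tg)
  also have "\<dots> = ip f f + 2 * t * ip f g + t\<^sup>2 * ip g g"
    using assms tg ip_commute[OF assms]
    by (simp add: ip_add_left ip_add_right ip_scale_left ip_scale_right add_mem
        power2_eq_square algebra_simps)
  also have "\<dots> = ip f f - (ip f g)\<^sup>2 / ip g g"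
    using False by (simp add: t_def field_simps power2_eq_square)
  finally show ?thesis
    using False ip_nonneg[OF assms(2)] by (simp add: field_simps)
qed

text \<open>The sign sits inside the coefficients so that the closure and pairing rules for kernel
  sums apply directly.\<close>

definition residual :: "(nat \<Rightarrow> 'x) \<Rightarrow> nat \<Rightarrow> 'x \<Rightarrow> 'x \<Rightarrow> real" where
  "residual X N x = (\<lambda>z. k x z + (\<Sum>i<N. - vec_index (gpr_weights k X N x) i * k (X i) z))"

lemma residual_mem: "residual X N x \<in> H"
  unfolding residual_def by (intro add_mem kernel_mem kernel_sum_mem)

text \<open>The residual is the Riesz representer of the error functional at \<open>x\<close>; this
  turns pointwise errors into inner products.\<close>

lemma ip_residual:
  assumes "invertible_mat (gram k X N)" "y \<in> H"
  shows "ip y (residual X N x) = y x - gpr_mean k X N y x"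
  unfolding residual_def ip_add_right[OF kernel_mem kernel_sum_mem assms(2)] ip_kernel_sum[OF assms(2)]
  by (simp add: assms reproducing gpr_mean_eq_weights[OF kernel_sym] sum_negf)

lemma ip_residual_self:
  assumes "invertible_mat (gram k X N)"
  shows "ip (residual X N x) (residual X N x) = gpr_var k X N x"
proof -
  let ?g = "residual X N x"
  \<comment> \<open>Pair the residual with \<open>k z\<close> in two ways: the reproducing property
    evaluates the residual at \<open>z\<close>, the representer formula gives the error for the
    function \<open>k z\<close>.\<close>
  have eq: "?g z = k z x - gpr_mean k X N (k z) x" for z
    using ip_residual[OF assms kernel_mem] ip_commute[OF kernel_mem residual_mem]
    by (metis reproducing residual_mem)
  then have "?g (X i) = 0" if "i < N" for i
    using gpr_mean_kernel_at_sample[OF kernel_sym assms that] kernel_sym by (simp add: sym_kernel_def)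
  then have "gpr_mean k X N ?g x = 0"
    by (simp add: gpr_mean_eq_weights[OF kernel_sym assms])
  then show ?thesis
    by (simp add: ip_residual[OF assms residual_mem] eq gpr_var_eq_mean)
qed

text \<open>The variance is a squared norm; hence squaring \<open>gpr_sd\<close> recovers
  it.\<close>

lemma gpr_var_nonneg: "invertible_mat (gram k X N) \<Longrightarrow> 0 \<le> gpr_var k X N x"
  using ip_nonneg[OF residual_mem, of X N x] by (simp add: ip_residual_self)

lemma normalize:
  assumes "g \<in> H" "0 < ip g g"
  shows "(\<lambda>z. (1 / sqrt (ip g g)) * g z) \<in> {y \<in> H. ip_norm ip y = 1}"
proof -
  define a where "a = 1 / sqrt (ip g g)"
  have "a * (a * ip g g) = 1"
    using assms(2) by (simp add: a_def field_simps)
  then have "(\<lambda>z. a * g z) \<in> {y \<in> H. ip_norm ip y = 1}"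
    using assms(1) by (simp add: ip_norm_def scale_mem ip_scale_left ip_scale_right)
  then show ?thesis
    by (simp only: a_def)
qed

text \<open>A zero section at the first data point would give the Gram matrix a zero row. The lemma
  keeps the supremum from ranging over an empty set.\<close>

lemma ex_unit:
  assumes "invertible_mat (gram k X N)" "1 \<le> N"
  shows "\<exists>y. y \<in> {y \<in> H. ip_norm ip y = 1}"
proof -
  have "k (X 0) \<noteq> (\<lambda>_. 0)"
  proof
    assume z: "k (X 0) = (\<lambda>_. 0)"
    let ?v = "Matrix.vec N (\<lambda>_. 1::real)"
    have "vec_index (gram k X N *\<^sub>v (gram_inv k X N *\<^sub>v ?v)) 0 = 0"
      using assms(2) gram_inv_carrier_right_inverse(1)[OF assms(1)]
      by (simp add: gram_def scalar_prod_def z)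
    then show False
      using assms(2) gram_mult_gram_inv_vec[OF assms(1), of ?v] by simp
  qed
  then have "0 < ip (k (X 0)) (k (X 0))"
    using ip_definite ip_nonneg kernel_mem by (metis order_le_less)
  then show ?thesis
    using normalize[OF kernel_mem] by blast
qed

text \<open>The bound is shown to be attained, so the real supremum is a genuine maximum and
  boundedness is no issue.\<close>

lemma SUP_sq_error_eq_gpr_var:
  assumes "invertible_mat (gram k X N)" "1 \<le> N"
  shows "(SUP y\<in>{y \<in> H. ip_norm ip y = 1}. (gpr_mean k X N y x - y x)\<^sup>2) = gpr_var k X N x"
proof -
  let ?g = "residual X N x" and ?U = "{y \<in> H. ip_norm ip y = 1}"
  let ?v = "gpr_var k X N x"
  have err: "(gpr_mean k X N y x - y x)\<^sup>2 = (ip y ?g)\<^sup>2" if "y \<in> H" for y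
    using ip_residual[OF assms(1) that] by (simp add: power2_commute)
  have le: "(gpr_mean k X N y x - y x)\<^sup>2 \<le> ?v" if "y \<in> ?U" for y
    using Cauchy_Schwarz[of y ?g] that residual_mem ip_residual_self[OF assms(1)]
    by (simp add: err ip_norm_def)
  have "\<exists>y\<in>?U. (gpr_mean k X N y x - y x)\<^sup>2 = ?v"
  proof (cases "?v = 0")
    \<comment> \<open>The zero residual cannot be normalized, but then every unit vector has error
      0.\<close>
    case True
    then show ?thesis
      using ex_unit[OF assms] le by (metis order_antisym zero_le_power2)
  next
    case False
    then have pos: "0 < ip ?g ?g"
      using gpr_var_nonneg[OF assms(1), of x] by (simp add: ip_residual_self[OF assms(1)])
    let ?y = "\<lambda>z. (1 / sqrt (ip ?g ?g)) * ?g z"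
    have "?y \<in> ?U"
      by (rule normalize[OF residual_mem pos])
    moreover have "(ip ?y ?g)\<^sup>2 = ?v"
      unfolding ip_scale_left[OF residual_mem residual_mem]
      using pos by (simp add: power_divide power2_eq_square ip_residual_self[OF assms(1), symmetric])
    ultimately show ?thesis
      by (metis (no_types, lifting) err mem_Collect_eq)
  qed
  then show ?thesis
    using le by (intro cSup_eq_maximum) (auto simp: image_iff)
qed

end

section \<open>Absolute continuity along a sequence of sets\<close>

text \<open>Split \<open>A n\<close> at level \<open>m\<close> of the density: the part above lies
  in sets decreasing to the empty set, the part below has mass at most \<open>m\<close> times its
  \<open>M\<close>-measure.\<close>

lemma tendsto_measure_density_zero:
  fixes M :: "'a measure" and h :: "'a \<Rightarrow> real"
  assumes [measurable]: "h \<in> borel_measurable M"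
    and fin: "finite_measure (density M (\<lambda>x. ennreal (h x)))"
    and A[measurable]: "\<And>n. A n \<in> sets M"
    and lim: "(\<lambda>n. emeasure M (A n)) \<longlonglongrightarrow> 0"
  shows "(\<lambda>n. measure (density M (\<lambda>x. ennreal (h x))) (A n)) \<longlonglongrightarrow> 0"
proof -
  let ?P = "density M (\<lambda>x. ennreal (h x))"
  interpret P: finite_measure ?P by (rule fin)
  let ?T = "\<lambda>m::nat. {x \<in> space M. real m < h x}"
  have "(\<Inter>m. ?T m) = {}"
  proof (rule equals0I)
    fix x assume "x \<in> (\<Inter>m. ?T m)"
    then have "real m < h x" for m
      by blast
    then show False
      using reals_Archimedean2[of "h x"] order_less_asym by blast
  qed
  moreover have "(\<lambda>m. emeasure ?P (?T m)) \<longlonglongrightarrow> emeasure ?P (\<Inter>m. ?T m)"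
    by (rule Lim_emeasure_decseq) (auto simp: decseq_def)
  ultimately have T: "(\<lambda>m. emeasure ?P (?T m)) \<longlonglongrightarrow> 0"
    by simp
  have bound: "emeasure ?P (A n) \<le> emeasure ?P (?T m) + of_nat m * emeasure M (A n)" for m n
  proof -
    have "emeasure ?P (A n) \<le> emeasure ?P (?T m \<union> (A n - ?T m))"
      by (rule emeasure_mono) auto
    also have "\<dots> \<le> emeasure ?P (?T m) + emeasure ?P (A n - ?T m)"
      by (rule emeasure_subadditive) auto
    also have "emeasure ?P (A n - ?T m) \<le> (\<integral>\<^sup>+x. of_nat m * indicator (A n) x \<partial>M)"
      using sets.sets_into_space[OF A]
      by (auto simp: emeasure_density not_less ennreal_of_nat_eq_real_of_nat
          intro!: nn_integral_mono ennreal_leI split: split_indicator)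
    also have "\<dots> = of_nat m * emeasure M (A n)"
      by (simp add: nn_integral_cmult_indicator)
    finally show ?thesis
      by (simp add: add_left_mono)
  qed
  have "(\<lambda>n. emeasure ?P (A n)) \<longlonglongrightarrow> 0"
  proof (rule order_tendstoI)
    fix e :: ennreal assume "0 < e"
    \<comment> \<open>The level \<open>m\<close> is fixed first, independently of \<open>n\<close>;
      only then does \<open>n\<close> grow.\<close>
    then obtain m where m: "emeasure ?P (?T m) < e"
      using order_tendstoD(2)[OF T, of e] by (auto simp: eventually_sequentially)
    have "(\<lambda>n. emeasure ?P (?T m) + of_nat m * emeasure M (A n)) \<longlonglongrightarrow> emeasure ?P (?T m) + of_nat m * 0"
      by (intro tendsto_add tendsto_const ennreal_tendsto_cmult lim) (simp add: of_nat_less_top)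
    then have "eventually (\<lambda>n. emeasure ?P (?T m) + of_nat m * emeasure M (A n) < e) sequentially"
      using m by (intro order_tendstoD(2)) auto
    then show "eventually (\<lambda>n. emeasure ?P (A n) < e) sequentially"
      by eventually_elim (use bound order.strict_trans1 in blast)
  qed auto
  then show ?thesis
    by (simp add: P.emeasure_eq_measure ennreal_tendsto_0_iff)
qed

section \<open>Convergence in measure of the worst-case error\<close>

theorem theorem3p4:
  fixes k :: "real ^ 'n \<Rightarrow> real ^ 'n \<Rightarrow> real"
    and H :: "(real ^ 'n \<Rightarrow> real) set"
    and ip :: "(real ^ 'n \<Rightarrow> real) \<Rightarrow> (real ^ 'n \<Rightarrow> real) \<Rightarrow> real"
    and P :: "(real ^ 'n) measure"
    and px :: "real ^ 'n \<Rightarrow> real"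
    and X :: "nat \<Rightarrow> real ^ 'n"
    and f :: "real ^ 'n \<Rightarrow> real"
    and p :: "nat \<Rightarrow> real \<Rightarrow> real"
  assumes "sym_kernel k" and "pos_def_kernel k"
    and "rkhs k H ip"
    and "px \<in> borel_measurable borel" and "\<And>x. 0 \<le> px x"
    and "P = density lborel (\<lambda>x. ennreal (px x))" and "prob_space P"
    and "\<And>N. 1 \<le> N \<Longrightarrow> invertible_mat (gram k X N)"
    and "\<And>N. 1 \<le> N \<Longrightarrow> gpr_sd k X N \<in> borel_measurable borel"
    and "\<And>N. 1 \<le> N \<Longrightarrow> is_pdf_of P (gpr_mean k X N f) (p N)"
    and "(\<lambda>N. \<integral>\<^sup>+ x. ennreal (px x / p N (gpr_mean k X N f x) * (gpr_sd k X N x)\<^sup>2) \<partial>lborel)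
           \<longlonglongrightarrow> 0"
  shows "\<forall>q>0. (\<lambda>N. \<P>(x in P.
            (SUP y\<in>{y \<in> H. ip_norm ip y = 1}. (gpr_mean k X N y x - y x)\<^sup>2)
              \<le> q * (p N (gpr_mean k X N f x) / px x))) \<longlonglongrightarrow> 1"
proof (intro allI impI)
  fix q :: real assume q: "q > 0"
  interpret rkhs k H ip by fact
  interpret P: prob_space P by fact
  note inv = assms(8)
  note [measurable] = assms(4)
  \<comment> \<open>\<open>m\<close> regresses the fixed \<open>f\<close> and enters only through
    the density; the supremum regresses each \<open>y\<close> separately and becomes
    \<open>v\<close>.\<close>
  define m where "m N = gpr_mean k X N f" for N
  define v where "v N = gpr_var k X N" for N
  define w where "w N x = px x / p N (m N x) * v N x" for N x
  define E where "E N = {x \<in> space P. v N x \<le> q * (p N (m N x) / px x)}" for N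
  have sets_P [simp, measurable_cong]: "sets P = sets borel"
    by (simp add: assms(6))
  have sd: "(gpr_sd k X N x)\<^sup>2 = v N x" if "1 \<le> N" for N x
    using gpr_var_nonneg[OF inv[OF that]] by (simp add: gpr_sd_def v_def)
  have v_meas: "v N \<in> borel_measurable borel" if "1 \<le> N" for N
    using borel_measurable_power[OF assms(9)[OF that], of 2] by (simp add: sd[OF that])
  have pdf: "\<And>t. 0 \<le> p N t" "distributed P lborel (m N) (\<lambda>t. ennreal (p N t))" if "1 \<le> N" for N
    using assms(10)[OF that] by (auto simp: is_pdf_of_def m_def)
  have m_meas: "m N \<in> borel_measurable borel" if "1 \<le> N" for N
    using distributed_measurable[OF pdf(2)[OF that]] by (simp add: assms(6))
  have p_meas: "p N \<in> borel_measurable borel" if "1 \<le> N" for N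
    using distributed_real_measurable[OF pdf(1)[OF that] pdf(2)[OF that]] by simp
  have w_meas: "w N \<in> borel_measurable borel" if "1 \<le> N" for N
  proof -
    note [measurable] = v_meas[OF that] m_meas[OF that] p_meas[OF that]
    show ?thesis unfolding w_def by measurable
  qed
  have E_sets: "E N \<in> sets P" if "1 \<le> N" for N
  proof -
    note [measurable] = v_meas[OF that] m_meas[OF that] p_meas[OF that]
    show ?thesis unfolding E_def by measurable
  qed
  \<comment> \<open>Rearranging the failed inequality into \<open>q < w N x\<close> requires both
    densities to be positive, which holds almost surely.\<close>
  have bad: "1 - measure P (E N) \<le> measure P {x. q < w N x}" if "1 \<le> N" for N
  proof -
    note [measurable] = w_meas[OF that] E_sets[OF that]
    have "AE x in P. 0 < p N (m N x)"
    proof -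
      note [measurable] = p_meas[OF that]
      \<comment> \<open>A law with density \<open>p N\<close> gives no mass to the zero set of
        \<open>p N\<close>.\<close>
      have "AE t in distr P lborel (m N). 0 < p N t"
        unfolding distributed_distr_eq_density[OF pdf(2)[OF that]]
        by (simp add: AE_density)
      then show ?thesis
        by (rule AE_distrD[OF distributed_measurable[OF pdf(2)[OF that]]])
    qed
    moreover have "AE x in P. 0 < px x"
      unfolding assms(6) using assms(5) by (simp add: AE_density)
    ultimately have "AE x in P. x \<in> space P - E N \<longrightarrow> x \<in> {x. q < w N x}"
    proof eventually_elim
      case (elim x)
      have "q < w N x" if "\<not> v N x \<le> q * (p N (m N x) / px x)"
      proof -
        have "q * (p N (m N x) / px x) < v N x"
          using that by simp
        then have "q * p N (m N x) < px x * v N x"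
          using elim by (simp add: pos_divide_less_eq mult.commute)
        then show ?thesis
          using elim by (simp add: w_def pos_less_divide_eq)
      qed
      then show ?case
        by (simp add: E_def)
    qed
    then have "measure P (space P - E N) \<le> measure P {x. q < w N x}"
      by (intro P.finite_measure_mono_AE) auto
    then show ?thesis
      unfolding P.prob_compl[OF E_sets[OF that]] .
  qed
  \<comment> \<open>Since \<open>w\<close> already contains \<open>px\<close>, its integral is
    against Lebesgue measure, and so is Markov's inequality. The index starts at one sample, where
    the regression hypotheses begin.\<close>
  have "(\<lambda>N. emeasure lborel {x. q < w (Suc N) x}) \<longlonglongrightarrow> 0"
  proof (rule tendsto_sandwich[OF _ _ tendsto_const])
    let ?I = "\<lambda>N. \<integral>\<^sup>+x. ennreal (w (Suc N) x) \<partial>lborel"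
    have "?I \<longlonglongrightarrow> 0"
      using LIMSEQ_Suc[OF assms(11)] by (simp add: w_def m_def sd)
    then have "(\<lambda>N. ennreal (1 / q) * ?I N) \<longlonglongrightarrow> ennreal (1 / q) * 0"
      by (intro ennreal_tendsto_cmult) auto
    then show "(\<lambda>N. ennreal (1 / q) * ?I N) \<longlonglongrightarrow> 0"
      by simp
    have "emeasure lborel {x. q < w (Suc N) x} \<le> ennreal (1 / q) * ?I N" for N
    proof -
      note [measurable] = w_meas[of "Suc N", simplified]
      have "emeasure lborel {x. q < w (Suc N) x}
          \<le> emeasure lborel {x \<in> UNIV. 1 \<le> ennreal (1 / q) * ennreal (w (Suc N) x)}"
        using q by (intro emeasure_mono) (auto simp: ennreal_mult'[symmetric] field_simps)
      also have "\<dots> \<le> ennreal (1 / q) * (\<integral>\<^sup>+x. ennreal (w (Suc N) x) * indicator UNIV x \<partial>lborel)"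
        by (rule nn_integral_Markov_inequality) auto
      finally show ?thesis by simp
    qed
    then show "eventually (\<lambda>N. emeasure lborel {x. q < w (Suc N) x} \<le> ennreal (1 / q) * ?I N) sequentially"
      by simp
  qed auto
  then have "(\<lambda>N. measure P {x. q < w (Suc N) x}) \<longlonglongrightarrow> 0"
    unfolding assms(6) using w_meas P.finite_measure_axioms assms(6)
    by (intro tendsto_measure_density_zero) auto
  then have lower: "(\<lambda>N. 1 - measure P {x. q < w (Suc N) x}) \<longlonglongrightarrow> 1"
    using tendsto_diff[OF tendsto_const[of "1::real" sequentially], of "\<lambda>N. measure P {x. q < w (Suc N) x}" 0]
    by simp
  have "1 - measure P {x. q < w (Suc N) x} \<le> measure P (E (Suc N))" for N
    using bad[of "Suc N"] by simp
  then have "(\<lambda>N. measure P (E (Suc N))) \<longlonglongrightarrow> 1"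
    by (intro tendsto_sandwich[OF _ _ lower tendsto_const]) (auto intro: P.prob_le_1)
  then show "(\<lambda>N. \<P>(x in P. (SUP y\<in>{y \<in> H. ip_norm ip y = 1}. (gpr_mean k X N y x - y x)\<^sup>2)
              \<le> q * (p N (gpr_mean k X N f x) / px x))) \<longlonglongrightarrow> 1"
    by (subst filterlim_sequentially_Suc[symmetric])
      (simp add: SUP_sq_error_eq_gpr_var inv E_def m_def v_def)
qed

end
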